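(* Let $\mathfrak{O}$ be the valuation ring of a non-Archimedean local field of arbitrary characteristic. Let $q$ be the residue field size of $\mathfrak{O}$. Then $$\mathsf{Z}^{\mathsf{ask}}_{\mathrm{M}_{d\times e}(\mathfrak{O})}(T) = \frac{1-q^{-e}T}{(1-T)(1-q^{d-e}T)}.$$
   Context: Let $\mathfrak{P}$ be the maximal ideal of $\mathfrak{O}$ and $\mathfrak{O}_n = \mathfrak{O}/\mathfrak{P}^n$. Matrices in $\mathrm{M}_{d\times e}(R)$ act by right multiplication on row vectors: $a \in \mathrm{M}_{d\times e}(R)$ gives the map $R^d \to R^e$, $x \mapsto xa$, with kernel $\mathrm{Ker}(a)\subset R^d$. For a finite ring $R$ and a submodule $N \subset \mathrm{M}_{d\times e}(R)$, the average size of the kernel is $\mathrm{ask}(N) = |N|^{-1}\sum_{a\in N} |\mathrm{Ker}(a)|$. For an $\mathfrak{O}$-submodule $M \subset \mathrm{M}_{d\times e}(\mathfrak{O})$, let $M_n \subset \mathrm{M}_{d\times e}(\mathfrak{O}_n)$ be the image of $M$ under entrywise reduction modulo $\mathfrak{P}^n$. The ask zeta function of $M$ is $\mathsf{Z}^{\mathsf{ask}}_M(T) = \sum_{n=0}^\infty \mathrm{ask}(M_n)\, T^n \in \mathbf{Q}[[T]]$. *)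

theory Defs
  imports
    "HOL-Algebra.Algebra"
    "HOL-Computational_Algebra.Formal_Power_Series"
    "Jordan_Normal_Form.Matrix"
begin

text \<open>
  A non-Archimedean local field, of any characteristic, is a field that is complete with respect
  to a (normalised) discrete valuation and has finite residue field.  The valuation \<open>v\<close> is
  only specified on nonzero elements; the convention that zero has infinite valuation appears
  as explicit disjuncts \<open>x = \<zero> \<or> m \<le> v x\<close>.
\<close>

definition valuation_ring :: "('a, 'b) ring_scheme \<Rightarrow> ('a \<Rightarrow> int) \<Rightarrow> ('a, 'b) ring_scheme"
  where "valuation_ring K v = K\<lparr>carrier := {x \<in> carrier K. x = \<zero>\<^bsub>K\<^esub> \<or> 0 \<le> v x}\<rparr>"

text \<open>Meaningful only for local rings; see \<open>maximal_ideal_valuation_ring\<close> below.\<close>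

definition maximal_ideal :: "('a, 'b) ring_scheme \<Rightarrow> 'a set"
  where "maximal_ideal R = (THE I. maximalideal I R)"

definition residue_field :: "('a, 'b) ring_scheme \<Rightarrow> 'a set ring"
  where "residue_field R = R Quot maximal_ideal R"

locale discretely_valued_field = field K for K :: "('a, 'b) ring_scheme" (structure) +
  fixes v :: "'a \<Rightarrow> int"
  assumes valuation_mult:
      "\<lbrakk>x \<in> carrier K - {\<zero>}; y \<in> carrier K - {\<zero>}\<rbrakk> \<Longrightarrow> v (x \<otimes> y) = v x + v y"
    and valuation_add:
      "\<lbrakk>x \<in> carrier K - {\<zero>}; y \<in> carrier K - {\<zero>}; x \<oplus> y \<noteq> \<zero>\<rbrakk>
        \<Longrightarrow> min (v x) (v y) \<le> v (x \<oplus> y)"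
    and valuation_surj: "v ` (carrier K - {\<zero>}) = UNIV"
begin

definition Cauchy_seq :: "(nat \<Rightarrow> 'a) \<Rightarrow> bool"
  where "Cauchy_seq s \<longleftrightarrow>
    (\<forall>m. \<exists>N. \<forall>i\<ge>N. \<forall>j\<ge>N. s i \<ominus> s j = \<zero> \<or> m \<le> v (s i \<ominus> s j))"

definition converges_to :: "(nat \<Rightarrow> 'a) \<Rightarrow> 'a \<Rightarrow> bool"
  where "converges_to s l \<longleftrightarrow> (\<forall>m. \<exists>N. \<forall>i\<ge>N. s i \<ominus> l = \<zero> \<or> m \<le> v (s i \<ominus> l))"

end

locale nonarch_local_field = discretely_valued_field +
  assumes complete:
      "\<lbrakk>range s \<subseteq> carrier K; Cauchy_seq s\<rbrakk> \<Longrightarrow> \<exists>l\<in>carrier K. converges_to s l"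
    and finite_residue_field: "finite (carrier (residue_field (valuation_ring K v)))"

text \<open>The quotient \<open>R / P\<^sup>n\<close> of a local ring \<open>R\<close> with maximal ideal \<open>P\<close>;
  for \<open>n = 0\<close> this is the zero ring.\<close>

definition maximal_ideal_power :: "('a, 'b) ring_scheme \<Rightarrow> nat \<Rightarrow> 'a set"
  where "maximal_ideal_power R n = maximal_ideal R [^]\<^bsub>ideals_set R\<^esub> n"

definition quot_level :: "('a, 'b) ring_scheme \<Rightarrow> nat \<Rightarrow> 'a set ring"
  where "quot_level R n = R Quot maximal_ideal_power R n"

text \<open>
  Matrices and vectors are those of \<^theory>\<open>Jordan_Normal_Form.Matrix\<close>.  The arithmetic there is
  tied to type classes, so the action of a matrix on row vectors is spelled out for a ring given
  by a record.
\<close>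

definition matrices :: "('a, 'b) ring_scheme \<Rightarrow> nat \<Rightarrow> nat \<Rightarrow> 'a mat set"
  where "matrices R d e = {A \<in> carrier_mat d e. elements_mat A \<subseteq> carrier R}"

definition row_vectors :: "('a, 'b) ring_scheme \<Rightarrow> nat \<Rightarrow> 'a vec set"
  where "row_vectors R d = {x \<in> carrier_vec d. vec_set x \<subseteq> carrier R}"

definition vec_mat_mult :: "('a, 'b) ring_scheme \<Rightarrow> 'a vec \<Rightarrow> 'a mat \<Rightarrow> 'a vec"
  where "vec_mat_mult R x A =
    vec (dim_col A) (\<lambda>j. \<Oplus>\<^bsub>R\<^esub>i\<in>{..<dim_row A}. x $ i \<otimes>\<^bsub>R\<^esub> A $$ (i, j))"

definition mat_ker :: "('a, 'b) ring_scheme \<Rightarrow> 'a mat \<Rightarrow> 'a vec set"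
  where "mat_ker R A =
    {x \<in> row_vectors R (dim_row A). vec_mat_mult R x A = vec (dim_col A) (\<lambda>_. \<zero>\<^bsub>R\<^esub>)}"

definition ask :: "('a, 'b) ring_scheme \<Rightarrow> 'a mat set \<Rightarrow> rat"
  where "ask R N = (\<Sum>A\<in>N. of_nat (card (mat_ker R A))) / of_nat (card N)"

definition reduction :: "('a, 'b) ring_scheme \<Rightarrow> nat \<Rightarrow> 'a mat set \<Rightarrow> 'a set mat set"
  where "reduction R n M = map_mat (\<lambda>x. maximal_ideal_power R n +>\<^bsub>R\<^esub> x) ` M"

definition ask_zeta :: "('a, 'b) ring_scheme \<Rightarrow> 'a mat set \<Rightarrow> rat fps"
  where "ask_zeta R M = Abs_fps (\<lambda>n. ask (quot_level R n) (reduction R n M))"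

context discretely_valued_field
begin

lemma valuation_one: "v \<one> = 0"
  using valuation_mult[of \<one> \<one>] by simp

lemma valuation_inv:
  assumes "x \<in> carrier K - {\<zero>}"
  shows "inv x \<in> carrier K - {\<zero>}" "v (inv x) = - v x"
proof -
  have u: "x \<in> Units K" using assms field_Units by simp
  then show i: "inv x \<in> carrier K - {\<zero>}" using field_Units Units_inv_Units by blast
  have "v (x \<otimes> inv x) = 0" using u valuation_one by simp
  then show "v (inv x) = - v x" using valuation_mult[OF assms i] by simp
qed

lemma valuation_minus:
  assumes "x \<in> carrier K - {\<zero>}"
  shows "v (\<ominus> x) = v x"
proof -
  have m: "\<ominus> \<one> \<in> carrier K - {\<zero>}" using add.inv_eq_1_iff by simp
  have "v (\<ominus> \<one> \<otimes> \<ominus> \<one>) = 0" using valuation_one by (simp add: l_minus)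
  then have "v (\<ominus> \<one>) = 0" using valuation_mult[OF m m] by simp
  moreover have "\<ominus> \<one> \<otimes> x = \<ominus> x" using assms by (simp add: l_minus)
  ultimately show ?thesis using valuation_mult[OF m assms] by simp
qed

lemma valuation_ring_simps [simp]:
  "\<zero>\<^bsub>valuation_ring K v\<^esub> = \<zero>" "\<one>\<^bsub>valuation_ring K v\<^esub> = \<one>"
  "x \<otimes>\<^bsub>valuation_ring K v\<^esub> y = x \<otimes> y" "x \<oplus>\<^bsub>valuation_ring K v\<^esub> y = x \<oplus> y"
  "carrier (valuation_ring K v) = {x \<in> carrier K. x = \<zero> \<or> 0 \<le> v x}"
  by (simp_all add: valuation_ring_def)

lemma add_bound:
  assumes "x \<in> carrier K" "y \<in> carrier K" "x = \<zero> \<or> m \<le> v x" "y = \<zero> \<or> m \<le> v y"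
  shows "x \<oplus> y = \<zero> \<or> m \<le> v (x \<oplus> y)"
  using assms valuation_add[of x y] by (cases "x = \<zero>"; cases "y = \<zero>") auto

lemma mult_bound:
  assumes "x \<in> carrier K" "y \<in> carrier K" "x = \<zero> \<or> m \<le> v x" "y = \<zero> \<or> n \<le> v y"
  shows "x \<otimes> y = \<zero> \<or> m + n \<le> v (x \<otimes> y)"
  using assms valuation_mult[of x y] by (cases "x = \<zero>"; cases "y = \<zero>") auto

lemma minus_bound:
  assumes "x \<in> carrier K" "x = \<zero> \<or> m \<le> v x"
  shows "\<ominus> x = \<zero> \<or> m \<le> v (\<ominus> x)"
  using assms valuation_minus[of x] by (cases "x = \<zero>") auto

lemma cring_valuation_ring: "cring (valuation_ring K v)"
proof -
  have "subcring {x \<in> carrier K. x = \<zero> \<or> 0 \<le> v x} K"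
  proof (intro subcringI' subringI)
    fix x y assume "x \<in> {x \<in> carrier K. x = \<zero> \<or> 0 \<le> v x}" "y \<in> {x \<in> carrier K. x = \<zero> \<or> 0 \<le> v x}"
    then show "x \<otimes> y \<in> {x \<in> carrier K. x = \<zero> \<or> 0 \<le> v x}"
      "x \<oplus> y \<in> {x \<in> carrier K. x = \<zero> \<or> 0 \<le> v x}"
      using mult_bound[of x y 0 0] add_bound[of x y 0] by auto
  next
    fix x assume "x \<in> {x \<in> carrier K. x = \<zero> \<or> 0 \<le> v x}"
    then show "\<ominus> x \<in> {x \<in> carrier K. x = \<zero> \<or> 0 \<le> v x}"
      using minus_bound[of x 0] by auto
  qed (auto simp: valuation_one)
  then show ?thesis
    using subcring_iff[of "{x \<in> carrier K. x = \<zero> \<or> 0 \<le> v x}"] by (auto simp: valuation_ring_def)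
qed

lemma minus_valuation_ring:
  assumes "x \<in> carrier (valuation_ring K v)"
  shows "\<ominus>\<^bsub>valuation_ring K v\<^esub> x = \<ominus> x"
proof -
  interpret O: cring "valuation_ring K v" by (rule cring_valuation_ring)
  have c: "\<ominus>\<^bsub>valuation_ring K v\<^esub> x \<in> carrier K" "x \<in> carrier K"
    using O.a_inv_closed[OF assms] assms by auto
  have "\<ominus>\<^bsub>valuation_ring K v\<^esub> x \<oplus> x = \<zero>" using O.l_neg[OF assms] by simp
  then show ?thesis using c minus_equality by force
qed

lemma ideal_positive_valuation:
  "ideal {x \<in> carrier K. x = \<zero> \<or> 0 < v x} (valuation_ring K v)" (is "ideal ?P ?O")
proof -
  interpret O: cring ?O by (rule cring_valuation_ring)
  show ?thesis
  proof (rule idealI[OF O.ring_axioms])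
    show "subgroup ?P (add_monoid ?O)"
    proof (rule O.add.subgroupI)
      fix a assume a: "a \<in> ?P"
      then have "a \<in> carrier ?O" by auto
      then show "\<ominus>\<^bsub>?O\<^esub> a \<in> ?P"
        using minus_bound[of a 1] a minus_valuation_ring[of a] by auto
    next
      fix a b assume "a \<in> ?P" "b \<in> ?P"
      then show "a \<oplus>\<^bsub>?O\<^esub> b \<in> ?P"
        using add_bound[of a b 1] by auto
    qed auto
    fix a x assume ax: "a \<in> ?P" "x \<in> carrier ?O"
    then show "x \<otimes>\<^bsub>?O\<^esub> a \<in> ?P" "a \<otimes>\<^bsub>?O\<^esub> x \<in> ?P"
      using mult_bound[of x a 0 1] mult_bound[of a x 1 0] by auto
  qed
qed

lemma proper_ideal_subset:
  assumes I: "ideal I (valuation_ring K v)" and ne: "I \<noteq> carrier (valuation_ring K v)"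
  shows "I \<subseteq> {x \<in> carrier K. x = \<zero> \<or> 0 < v x}"
proof
  interpret I: ideal I "valuation_ring K v" by (rule I)
  fix x assume x: "x \<in> I"
  then have xc: "x \<in> carrier K" "x = \<zero> \<or> 0 \<le> v x" using I.Icarr[OF x] by auto
  show "x \<in> {x \<in> carrier K. x = \<zero> \<or> 0 < v x}"
  proof (rule ccontr)
    assume "\<not> ?thesis"
    then have x0: "x \<in> carrier K - {\<zero>}" "v x = 0" using xc by auto
    then have "inv x \<in> carrier (valuation_ring K v)" using valuation_inv[of x] by auto
    from I.I_l_closed[OF x this] have "inv x \<otimes> x \<in> I" by simp
    then have "\<one> \<in> I" using x0 field_Units by (metis Units_l_inv)
    then show False using I.one_imp_carrier ne by simp
  qed
qed

lemma maximal_ideal_valuation_ring: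
  "maximal_ideal (valuation_ring K v) = {x \<in> carrier K. x = \<zero> \<or> 0 < v x}"
  "\<exists>!I. maximalideal I (valuation_ring K v)"
proof -
  let ?P = "{x \<in> carrier K. x = \<zero> \<or> 0 < v x}" and ?O = "valuation_ring K v"
  have P: "maximalideal ?P ?O"
  proof (rule maximalidealI[OF ideal_positive_valuation])
    have "\<one> \<in> carrier ?O" "\<one> \<notin> ?P" using valuation_one by auto
    then show "carrier ?O \<noteq> ?P" by blast
    fix J assume "ideal J ?O" "?P \<subseteq> J"
    then show "J = ?P \<or> J = carrier ?O" using proper_ideal_subset[of J] by blast
  qed
  have eq: "I = ?P" if "maximalideal I ?O" for I
  proof -
    interpret I: maximalideal I ?O by (rule that)
    have "I \<subseteq> ?P" using proper_ideal_subset[OF I.ideal_axioms] I.I_notcarr by simp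
    then have "?P = I \<or> ?P = carrier ?O"
      by (intro I.I_maximal[OF ideal_positive_valuation]) auto
    moreover have "?P \<noteq> carrier ?O" using maximalideal.I_notcarr[OF P] by simp
    ultimately show ?thesis by simp
  qed
  show "\<exists>!I. maximalideal I ?O" using P eq by blast
  show "maximal_ideal ?O = ?P"
    unfolding maximal_ideal_def using P eq by (intro the_equality)
qed

end

end

theory Submission
  imports Defs
begin

text \<open>
Write \<open>\<O>\<close> for the valuation ring, \<open>P\<close> for its maximal ideal and \<open>S = \<O>/P\<^sup>n\<close>.  Averaging the kernel
size over all matrices amounts to counting the pairs \<open>(x, A)\<close> with \<open>x A = 0\<close>, and this count is
easier for fixed \<open>x\<close>: the columns of \<open>A\<close> are then \<open>e\<close> independent solutions \<open>a\<close> of the single linear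
equation \<open>x \<cdot> a = 0\<close>.  The map \<open>a \<mapsto> x \<cdot> a\<close> on \<open>S\<^sup>d\<close> is additive with image the ideal \<open>I(x)\<close> generated by
the entries of \<open>x\<close>, so it has \<open>|S|\<^sup>d / |I(x)|\<close> zeros.  Dividing by the number \<open>|S|\<^bsup>de\<^esup>\<close> of matrices
gives, over any finite commutative ring, the formula \<open>ask_matrices\<close>: the average is the sum over
all \<open>x\<close> of \<open>|I(x)|\<^bsup>-e\<^esup>\<close>.

The ideals of \<open>S\<close> form the chain \<open>P\<^sup>k/P\<^sup>n\<close> for \<open>k \<le> n\<close>, whose members have \<open>q\<^bsup>n-k\<^esup>\<close> elements.  Those
\<open>x\<close> with \<open>I(x)\<close> contained in \<open>P\<^sup>k/P\<^sup>n\<close> are the vectors with all entries there, \<open>q\<^bsup>(n-k)d\<^esup>\<close> in number.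
Subtracting consecutive counts shows that, for \<open>j = n - k > 0\<close>, exactly \<open>q\<^bsup>jd\<^esup> - q\<^bsup>(j-1)d\<^esup>\<close> vectors have
\<open>|I(x)| = q\<^sup>j\<close>, while \<open>x = 0\<close> alone contributes \<open>1\<close> (\<open>ask_matrices_chain_ring\<close>).

With \<open>r = q\<^bsup>d-e\<^esup>\<close> and \<open>s = q\<^bsup>-e\<^esup>\<close> the term for \<open>j\<close> is \<open>r\<^sup>j - s r\<^bsup>j-1\<^esup>\<close>.  The \<open>n\<close>-th coefficient of the zeta
function is therefore a partial sum of a combination of two geometric series, which accounts for
the factors \<open>1 - T\<close> and \<open>1 - r T\<close> of the denominator (\<open>fps_geometric_partial_sums\<close>).
\<close>

section \<open>Vectors and matrices over a ring\<close>

definition dot :: "('a, 'b) ring_scheme \<Rightarrow> 'a vec \<Rightarrow> 'a vec \<Rightarrow> 'a"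
  where "dot S x a = (\<Oplus>\<^bsub>S\<^esub>i\<in>{..<dim_vec x}. x $ i \<otimes>\<^bsub>S\<^esub> a $ i)"

text \<open>
Vectors with entries in an arbitrary set: besides the row vectors over a ring, the vectors over
each of its ideals have to be counted.
\<close>

definition vecs_over :: "'a set \<Rightarrow> nat \<Rightarrow> 'a vec set"
  where "vecs_over J d = {x \<in> carrier_vec d. vec_set x \<subseteq> J}"

lemma row_vectors_eq_vecs_over: "row_vectors S d = vecs_over (carrier S) d"
  by (simp add: row_vectors_def vecs_over_def)

lemma mem_vecs_over_iff: "x \<in> vecs_over J d \<longleftrightarrow> dim_vec x = d \<and> (\<forall>i<d. x $ i \<in> J)"
  unfolding vecs_over_def vec_set_def carrier_vec_def by auto

lemma vecs_over_mono: "J \<subseteq> J' \<Longrightarrow> vecs_over J d \<subseteq> vecs_over J' d"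
  by (auto simp: vecs_over_def)

lemma bij_betw_vecs_over:
  "bij_betw (\<lambda>x. \<lambda>i\<in>{..<d}. x $ i) (vecs_over J d) ({..<d} \<rightarrow>\<^sub>E J)"
proof (rule bij_betw_byWitness[where f' = "vec d"])
  show "\<forall>x\<in>vecs_over J d. vec d (\<lambda>i\<in>{..<d}. x $ i) = x"
    by (intro ballI eq_vecI) (simp_all add: mem_vecs_over_iff)
  show "\<forall>c\<in>{..<d} \<rightarrow>\<^sub>E J. (\<lambda>i\<in>{..<d}. vec d c $ i) = c"
  proof (intro ballI ext)
    fix c i assume c: "c \<in> {..<d} \<rightarrow>\<^sub>E J"
    show "(\<lambda>i\<in>{..<d}. vec d c $ i) i = c i"
      using PiE_arb[OF c, of i] by (cases "i < d") simp_all
  qed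
  show "(\<lambda>x. \<lambda>i\<in>{..<d}. x $ i) ` vecs_over J d \<subseteq> {..<d} \<rightarrow>\<^sub>E J"
    by (intro image_subsetI restrict_PiE_iff[THEN iffD2] ballI) (simp add: mem_vecs_over_iff)
  show "vec d ` ({..<d} \<rightarrow>\<^sub>E J) \<subseteq> vecs_over J d"
    by (intro image_subsetI) (auto simp: mem_vecs_over_iff)
qed

lemma card_vecs_over: "card (vecs_over J d) = card J ^ d"
  by (simp only: bij_betw_same_card[OF bij_betw_vecs_over] card_PiE finite_lessThan prod_constant card_lessThan)

lemma finite_vecs_over: "finite J \<Longrightarrow> finite (vecs_over J d)"
  by (simp only: bij_betw_finite[OF bij_betw_vecs_over] finite_PiE finite_lessThan)

lemma mem_matrices_iff:
  "A \<in> matrices S d e \<longleftrightarrow> A \<in> carrier_mat d e \<and> (\<forall>i<d. \<forall>j<e. A $$ (i, j) \<in> carrier S)"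
proof (cases "A \<in> carrier_mat d e")
  case True
  have "elements_mat A \<subseteq> carrier S \<longleftrightarrow> (\<forall>i<d. \<forall>j<e. A $$ (i, j) \<in> carrier S)"
  proof (intro iffI subsetI allI impI)
    fix i j assume "elements_mat A \<subseteq> carrier S" "i < d" "j < e"
    then show "A $$ (i, j) \<in> carrier S" using elements_matI[OF True, of i j] by (simp only: subset_iff)
  next
    fix a assume *: "\<forall>i<d. \<forall>j<e. A $$ (i, j) \<in> carrier S" and "a \<in> elements_mat A"
    from elements_matD[OF this(2)] obtain i j where "i < d" "j < e" "a = A $$ (i, j)"
      unfolding carrier_matD[OF True] by (elim exE conjE)
    then show "a \<in> carrier S" using * by simp
  qed
  then show ?thesis by (simp add: matrices_def True)
qed (simp add: matrices_def)

text \<open>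
A condition imposed on each column separately makes the columns independent.
\<close>

lemma bij_betw_cols:
  "bij_betw (\<lambda>A. \<lambda>j\<in>{..<e}. col A j)
     {A \<in> matrices S d e. \<forall>j<e. P (col A j)} ({..<e} \<rightarrow>\<^sub>E {a \<in> row_vectors S d. P a})"
proof (rule bij_betw_byWitness[where f' = "\<lambda>c. mat d e (\<lambda>(i, j). c j $ i)"])
  have col: "col (mat d e (\<lambda>(i, j). c j $ i)) j = c j"
    if "c \<in> {..<e} \<rightarrow>\<^sub>E {a \<in> row_vectors S d. P a}" "j < e" for c j
    using PiE_mem[OF that(1), of j] that(2)
    by (intro eq_vecI) (auto simp: row_vectors_eq_vecs_over mem_vecs_over_iff)
  let ?M = "{A \<in> matrices S d e. \<forall>j<e. P (col A j)}"
  let ?C = "{..<e} \<rightarrow>\<^sub>E {a \<in> row_vectors S d. P a}"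
  show "\<forall>A\<in>?M. mat d e (\<lambda>(i, j). (\<lambda>j\<in>{..<e}. col A j) j $ i) = A"
    by (auto simp: mem_matrices_iff)
  show "\<forall>c\<in>?C. (\<lambda>j\<in>{..<e}. col (mat d e (\<lambda>(i, j). c j $ i)) j) = c"
  proof (intro ballI ext)
    fix c j assume c: "c \<in> ?C"
    show "(\<lambda>j\<in>{..<e}. col (mat d e (\<lambda>(i, j). c j $ i)) j) j = c j"
      using PiE_arb[OF c, of j] col[OF c, of j] by (cases "j < e") simp_all
  qed
  show "(\<lambda>A. \<lambda>j\<in>{..<e}. col A j) ` ?M \<subseteq> ?C"
    by (intro image_subsetI restrict_PiE_iff[THEN iffD2])
      (auto simp: mem_matrices_iff row_vectors_eq_vecs_over mem_vecs_over_iff)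
  show "(\<lambda>c. mat d e (\<lambda>(i, j). c j $ i)) ` ?C \<subseteq> ?M"
  proof (intro subsetI, elim imageE, simp only:)
    fix c assume c: "c \<in> ?C"
    have "mat d e (\<lambda>(i, j). c j $ i) \<in> matrices S d e"
      using PiE_mem[OF c] by (auto simp: mem_matrices_iff row_vectors_eq_vecs_over mem_vecs_over_iff)
    then show "mat d e (\<lambda>(i, j). c j $ i) \<in> ?M"
      using PiE_mem[OF c] col[OF c] by auto
  qed
qed

lemma card_matrices_cols:
  "card {A \<in> matrices S d e. \<forall>j<e. P (col A j)} = card {a \<in> row_vectors S d. P a} ^ e"
  by (simp only: bij_betw_same_card[OF bij_betw_cols] card_PiE finite_lessThan prod_constant card_lessThan)

lemma card_matrices: "card (matrices S d e) = card (carrier S) ^ (d * e)"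
  using card_matrices_cols[of S d e "\<lambda>_. True"]
  by (simp add: row_vectors_eq_vecs_over card_vecs_over power_mult)

lemma finite_matrices:
  assumes "finite (carrier S)"
  shows "finite (matrices S d e)"
proof -
  have "finite {A \<in> matrices S d e. \<forall>j<e. True}"
    unfolding bij_betw_finite[OF bij_betw_cols[where P = "\<lambda>_. True"]] using assms
    by (intro finite_PiE) (simp_all add: row_vectors_eq_vecs_over finite_vecs_over)
  then show ?thesis by simp
qed

section \<open>The average kernel size over a finite commutative ring\<close>

lemma (in cring) mem_mat_ker_iff:
  assumes "A \<in> matrices R d e"
  shows "x \<in> mat_ker R A \<longleftrightarrow> x \<in> row_vectors R d \<and> (\<forall>j<e. dot R x (col A j) = \<zero>)"
proof -
  have A: "dim_row A = d" "dim_col A = e" using assms by (auto simp: mem_matrices_iff)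
  have "vec_mat_mult R x A = vec e (\<lambda>j. dot R x (col A j))" if x: "x \<in> row_vectors R d"
  proof -
    have "(\<Oplus>i\<in>{..<d}. x $ i \<otimes> A $$ (i, j)) = (\<Oplus>i\<in>{..<d}. x $ i \<otimes> col A j $ i)" if "j < e" for j
    proof (rule finsum_cong')
      show "(\<lambda>i. x $ i \<otimes> col A j $ i) \<in> {..<d} \<rightarrow> carrier R"
        using x assms \<open>j < e\<close> A
        by (intro Pi_I m_closed) (simp_all add: mem_matrices_iff row_vectors_eq_vecs_over mem_vecs_over_iff)
    qed (use \<open>j < e\<close> A in simp_all)
    moreover have "dim_vec x = d" using x by (simp add: row_vectors_eq_vecs_over mem_vecs_over_iff)
    ultimately show ?thesis unfolding vec_mat_mult_def dot_def A by (intro eq_vecI) simp_all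
  qed
  then show ?thesis unfolding mat_ker_def A by (auto simp: vec_eq_iff)
qed

text \<open>
Double counting of the pairs \<open>(x, A)\<close> with \<open>x A = 0\<close>.  For fixed \<open>x\<close> this condition constrains each
column of \<open>A\<close> on its own, whence the power \<open>e\<close>.
\<close>

lemma (in cring) sum_card_mat_ker:
  assumes fin: "finite (carrier R)"
  shows "(\<Sum>A\<in>matrices R d e. card (mat_ker R A)) =
    (\<Sum>x\<in>row_vectors R d. card {a \<in> row_vectors R d. dot R x a = \<zero>} ^ e)"
proof -
  have finV: "finite (row_vectors R d)"
    using fin by (simp add: row_vectors_eq_vecs_over finite_vecs_over)
  have "(\<Sum>A\<in>matrices R d e. card (mat_ker R A)) =
    (\<Sum>A\<in>matrices R d e. card {x \<in> row_vectors R d. \<forall>j<e. dot R x (col A j) = \<zero>})"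
  proof (rule sum.cong[OF refl])
    fix A assume "A \<in> matrices R d e"
    then have "mat_ker R A = {x \<in> row_vectors R d. \<forall>j<e. dot R x (col A j) = \<zero>}"
      using mem_mat_ker_iff by blast
    then show "card (mat_ker R A) = card {x \<in> row_vectors R d. \<forall>j<e. dot R x (col A j) = \<zero>}"
      by simp
  qed
  also have "\<dots> = (\<Sum>x\<in>row_vectors R d.
      card {A \<in> matrices R d e. \<forall>j<e. dot R x (col A j) = \<zero>})"
    by (intro sum_multicount_gen finV finite_matrices fin ballI refl)
  also have "\<dots> = (\<Sum>x\<in>row_vectors R d. card {a \<in> row_vectors R d. dot R x a = \<zero>} ^ e)"
    by (intro sum.cong refl card_matrices_cols[where P = "\<lambda>a. dot R _ a = \<zero>"])
  finally show ?thesis .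
qed

text \<open>
The map \<open>a \<mapsto> x \<cdot> a\<close> is linear and takes the unit vectors to the entries of \<open>x\<close>; hence its image is
the ideal generated by these entries, which the next lemmas express without generating sets.
\<close>

lemma (in cring) dot_closed:
  assumes "x \<in> row_vectors R d" "a \<in> row_vectors R d"
  shows "dot R x a \<in> carrier R"
  using assms unfolding dot_def row_vectors_eq_vecs_over mem_vecs_over_iff
  by (intro finsum_closed) auto

lemma (in cring) dot_add:
  assumes "x \<in> row_vectors R d" "a \<in> row_vectors R d" "b \<in> row_vectors R d"
  shows "dot R x (vec d (\<lambda>i. a $ i \<oplus> b $ i)) = dot R x a \<oplus> dot R x b"
proof -
  have x: "dim_vec x = d" "\<And>i. i < d \<Longrightarrow> x $ i \<in> carrier R"
    and ab: "\<And>i. i < d \<Longrightarrow> a $ i \<in> carrier R" "\<And>i. i < d \<Longrightarrow> b $ i \<in> carrier R"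
    using assms by (auto simp: row_vectors_eq_vecs_over mem_vecs_over_iff)
  have "dot R x (vec d (\<lambda>i. a $ i \<oplus> b $ i)) =
      (\<Oplus>i\<in>{..<d}. x $ i \<otimes> a $ i \<oplus> x $ i \<otimes> b $ i)"
    unfolding dot_def x using x ab by (intro finsum_cong') (auto simp: r_distr)
  also have "\<dots> = dot R x a \<oplus> dot R x b"
    unfolding dot_def x using x ab by (intro finsum_addf) auto
  finally show ?thesis .
qed

lemma (in cring) dot_smult:
  assumes "x \<in> row_vectors R d" "a \<in> row_vectors R d" "c \<in> carrier R"
  shows "dot R x (vec d (\<lambda>i. c \<otimes> a $ i)) = c \<otimes> dot R x a"
proof -
  have x: "dim_vec x = d" "\<And>i. i < d \<Longrightarrow> x $ i \<in> carrier R"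
    and a: "\<And>i. i < d \<Longrightarrow> a $ i \<in> carrier R"
    using assms by (auto simp: row_vectors_eq_vecs_over mem_vecs_over_iff)
  have "dot R x (vec d (\<lambda>i. c \<otimes> a $ i)) = (\<Oplus>i\<in>{..<d}. c \<otimes> (x $ i \<otimes> a $ i))"
    unfolding dot_def x using x a assms by (intro finsum_cong') (auto simp: m_ac)
  also have "\<dots> = c \<otimes> dot R x a"
    unfolding dot_def x using x a assms by (intro finsum_rdistr[symmetric]) auto
  finally show ?thesis .
qed

lemma (in cring) dot_unit:
  assumes "x \<in> row_vectors R d" "k < d"
  shows "dot R x (vec d (\<lambda>i. if i = k then \<one> else \<zero>)) = x $ k"
proof -
  have x: "dim_vec x = d" "\<And>i. i < d \<Longrightarrow> x $ i \<in> carrier R"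
    using assms by (auto simp: row_vectors_eq_vecs_over mem_vecs_over_iff)
  have "dot R x (vec d (\<lambda>i. if i = k then \<one> else \<zero>)) =
      (\<Oplus>i\<in>{..<d}. if k = i then x $ i else \<zero>)"
    unfolding dot_def x using x by (intro finsum_cong') auto
  also have "\<dots> = x $ k" using assms x by (intro finsum_singleton) auto
  finally show ?thesis .
qed

lemma (in cring) ideal_dot_image:
  assumes x: "x \<in> row_vectors R d"
  shows "ideal (dot R x ` row_vectors R d) R" (is "ideal (?f ` ?V) R")
proof (rule idealI[OF ring_axioms])
  have smult: "c \<otimes> y \<in> ?f ` ?V" if y: "y \<in> ?f ` ?V" and c: "c \<in> carrier R" for c y
  proof -
    obtain a where a: "a \<in> ?V" "y = ?f a" using y by blast
    then have "vec d (\<lambda>i. c \<otimes> a $ i) \<in> ?V"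
      using c by (auto simp: row_vectors_eq_vecs_over mem_vecs_over_iff)
    then show ?thesis using dot_smult[OF x a(1) c] a by force
  qed
  then show l: "c \<otimes> y \<in> ?f ` ?V" if "y \<in> ?f ` ?V" "c \<in> carrier R" for c y using that by blast
  show "y \<otimes> c \<in> ?f ` ?V" if "y \<in> ?f ` ?V" "c \<in> carrier R" for c y
    using l[OF that] that x dot_closed by (auto simp: m_comm)
  show "subgroup (?f ` ?V) (add_monoid R)"
  proof (rule add.subgroupI)
    show "?f ` ?V \<subseteq> carrier R" using dot_closed[OF x] by auto
    have "vec d (\<lambda>_. \<zero>) \<in> ?V" by (auto simp: row_vectors_eq_vecs_over mem_vecs_over_iff)
    then show "?f ` ?V \<noteq> {}" by auto
    show "\<ominus> y \<in> ?f ` ?V" if "y \<in> ?f ` ?V" for y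
      using smult[OF that, of "\<ominus> \<one>"] that dot_closed[OF x] by (auto simp: l_minus)
    show "y \<oplus> z \<in> ?f ` ?V" if yz: "y \<in> ?f ` ?V" "z \<in> ?f ` ?V" for y z
    proof -
      obtain a b where ab: "a \<in> ?V" "y = ?f a" "b \<in> ?V" "z = ?f b" using yz by blast
      then have "vec d (\<lambda>i. a $ i \<oplus> b $ i) \<in> ?V"
        by (auto simp: row_vectors_eq_vecs_over mem_vecs_over_iff)
      then show ?thesis using dot_add[OF x ab(1,3)] ab by force
    qed
  qed
qed

lemma (in cring) dot_image_subset_iff:
  assumes x: "x \<in> row_vectors R d" and I: "ideal I R"
  shows "dot R x ` row_vectors R d \<subseteq> I \<longleftrightarrow> x \<in> vecs_over I d"
proof
  interpret I: ideal I R by (rule I)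
  assume *: "dot R x ` row_vectors R d \<subseteq> I"
  have "x $ k \<in> I" if "k < d" for k
  proof -
    have "vec d (\<lambda>i. if i = k then \<one> else \<zero>) \<in> row_vectors R d"
      by (auto simp: row_vectors_eq_vecs_over mem_vecs_over_iff)
    then show ?thesis using * dot_unit[OF x that] by force
  qed
  then show "x \<in> vecs_over I d" using x by (auto simp: row_vectors_eq_vecs_over mem_vecs_over_iff)
next
  interpret I: ideal I R by (rule I)
  assume *: "x \<in> vecs_over I d"
  show "dot R x ` row_vectors R d \<subseteq> I"
  proof safe
    fix a assume a: "a \<in> row_vectors R d"
    have "i < d \<Longrightarrow> x $ i \<otimes> a $ i \<in> I" for i
      using a * I.I_r_closed by (auto simp: row_vectors_eq_vecs_over mem_vecs_over_iff)
    moreover have "(\<Oplus>i\<in>A. f i) \<in> I" if "finite A" "\<forall>i\<in>A. f i \<in> I" for f and A :: "nat set"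
      using that
    proof (induction A)
      case (insert i A)
      then have "f \<in> A \<rightarrow> carrier R" "f i \<in> carrier R" using I.Icarr by auto
      with insert show ?case by simp
    qed simp
    ultimately show "dot R x a \<in> I"
      using * unfolding dot_def by (auto simp: mem_vecs_over_iff)
  qed
qed

text \<open>
The fibres of an additive map are translates of its kernel, so they all have the same size.
\<close>

lemma (in cring) card_dot_image_mult_card_ker:
  assumes fin: "finite (carrier R)" and x: "x \<in> row_vectors R d"
  shows "card (dot R x ` row_vectors R d) * card {a \<in> row_vectors R d. dot R x a = \<zero>} =
    card (carrier R) ^ d" (is "card (?f ` ?V) * card ?N = _")
proof -
  have finV: "finite ?V"
    using fin by (simp add: row_vectors_eq_vecs_over finite_vecs_over)
  have fibre: "card {a \<in> ?V. ?f a = y} = card ?N" if "y \<in> ?f ` ?V" for y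
  proof -
    obtain b where b: "b \<in> ?V" "y = ?f b" using \<open>y \<in> ?f ` ?V\<close> by blast
    define c where "c = vec d (\<lambda>i. \<ominus> b $ i)"
    have bc: "\<And>i. i < d \<Longrightarrow> b $ i \<in> carrier R" "\<And>i. i < d \<Longrightarrow> c $ i = \<ominus> b $ i"
      using b by (auto simp: row_vectors_eq_vecs_over mem_vecs_over_iff c_def)
    have c: "c \<in> ?V" using b by (auto simp: row_vectors_eq_vecs_over mem_vecs_over_iff c_def)
    have "c = vec d (\<lambda>i. \<ominus> \<one> \<otimes> b $ i)" using bc by (auto simp: c_def l_minus)
    then have fc: "?f c = \<ominus> y"
      using dot_smult[OF x b(1), of "\<ominus> \<one>"] dot_closed[OF x b(1)] b by (simp add: l_minus)
    have add_mem: "vec d (\<lambda>i. a $ i \<oplus> a' $ i) \<in> ?V" if "a \<in> ?V" "a' \<in> ?V" for a a'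
      using that by (auto simp: row_vectors_eq_vecs_over mem_vecs_over_iff)
    have y: "y \<in> carrier R" using dot_closed[OF x b(1)] b by simp
    have "bij_betw (\<lambda>a. vec d (\<lambda>i. a $ i \<oplus> c $ i)) {a \<in> ?V. ?f a = y} ?N"
    proof (rule bij_betw_byWitness[where f' = "\<lambda>a. vec d (\<lambda>i. a $ i \<oplus> b $ i)"])
      show "\<forall>a\<in>{a \<in> ?V. ?f a = y}.
          vec d (\<lambda>i. vec d (\<lambda>i. a $ i \<oplus> c $ i) $ i \<oplus> b $ i) = a"
        using bc by (auto simp: row_vectors_eq_vecs_over mem_vecs_over_iff a_assoc l_neg)
      show "\<forall>a\<in>?N. vec d (\<lambda>i. vec d (\<lambda>i. a $ i \<oplus> b $ i) $ i \<oplus> c $ i) = a"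
        using bc by (auto simp: row_vectors_eq_vecs_over mem_vecs_over_iff a_assoc r_neg)
      show "(\<lambda>a. vec d (\<lambda>i. a $ i \<oplus> c $ i)) ` {a \<in> ?V. ?f a = y} \<subseteq> ?N"
        using y c by (auto simp: add_mem dot_add[OF x] fc r_neg)
      show "(\<lambda>a. vec d (\<lambda>i. a $ i \<oplus> b $ i)) ` ?N \<subseteq> {a \<in> ?V. ?f a = y}"
        using y b by (auto simp: add_mem dot_add[OF x])
    qed
    then show ?thesis by (rule bij_betw_same_card)
  qed
  have "card ?V = (\<Sum>y\<in>?f ` ?V. card {a \<in> ?V. ?f a = y})"
    using sum.image_gen[OF finV, of "\<lambda>_. 1::nat" ?f] by simp
  also have "\<dots> = card (?f ` ?V) * card ?N" using fibre by simp
  finally show ?thesis by (simp add: row_vectors_eq_vecs_over card_vecs_over)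
qed

text \<open>
Replacing the size of the kernel of \<open>a \<mapsto> x \<cdot> a\<close> by \<open>|S|\<^sup>d\<close> divided by the size of the image makes the
factor \<open>|S|\<^bsup>de\<^esup>\<close> cancel against the number of matrices.
\<close>

lemma (in cring) ask_matrices:
  assumes fin: "finite (carrier R)"
  shows "ask R (matrices R d e) =
    (\<Sum>x\<in>row_vectors R d. 1 / of_nat (card (dot R x ` row_vectors R d)) ^ e)"
proof -
  let ?c = "of_nat (card (carrier R)) :: rat"
  have c: "?c \<noteq> 0" using fin by auto
  have eq: "of_nat (card {a \<in> row_vectors R d. dot R x a = \<zero>}) ^ e / ?c ^ (d * e) =
      1 / of_nat (card (dot R x ` row_vectors R d)) ^ e" if "x \<in> row_vectors R d" for x
  proof -
    let ?i = "of_nat (card (dot R x ` row_vectors R d)) :: rat"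
    let ?k = "of_nat (card {a \<in> row_vectors R d. dot R x a = \<zero>}) :: rat"
    have *: "?i * ?k = ?c ^ d"
      unfolding card_dot_image_mult_card_ker[OF fin that, symmetric] of_nat_mult[symmetric] of_nat_power[symmetric] ..
    then have "?i \<noteq> 0" using c by (metis mult_zero_left power_not_zero)
    moreover have "?i ^ e * ?k ^ e = ?c ^ (d * e)"
      by (simp only: power_mult_distrib[symmetric] * power_mult)
    ultimately show ?thesis using c
      by (subst frac_eq_eq) (simp_all only: power_not_zero mult_1_left mult.commute not_False_eq_True)
  qed
  have "ask R (matrices R d e) = (\<Sum>x\<in>row_vectors R d.
      of_nat (card {a \<in> row_vectors R d. dot R x a = \<zero>}) ^ e / ?c ^ (d * e))"
    unfolding ask_def of_nat_sum[symmetric] sum_card_mat_ker[OF fin] card_matrices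
    by (simp only: sum_divide_distrib of_nat_sum of_nat_power)
  then show ?thesis by (simp only: eq cong: sum.cong)
qed

text \<open>
When the ideals form a chain, the summand of \<open>ask_matrices\<close> depends only on the step of the
chain at which \<open>x\<close> sits: a vector over \<open>J k\<close> that is not a vector over \<open>J (k + 1)\<close> generates exactly
\<open>J k\<close>.  Adding these layers one at a time, starting from the zero ideal \<open>J n\<close>, yields the sum.
\<close>

lemma (in cring) ask_matrices_chain_ring:
  fixes J :: "nat \<Rightarrow> 'a set" and q n :: nat
  assumes ideals: "\<And>I. ideal I R \<longleftrightarrow> (\<exists>k\<le>n. I = J k)"
    and decreasing: "\<And>k l. k \<le> l \<Longrightarrow> l \<le> n \<Longrightarrow> J l \<subseteq> J k"
    and card_J: "\<And>k. k \<le> n \<Longrightarrow> card (J k) = q ^ (n - k)"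
    and J0: "J 0 = carrier R" and Jn: "J n = {\<zero>}" and q: "0 < q"
  shows "ask R (matrices R d e) =
    1 + (\<Sum>j<n. (of_nat q ^ (Suc j * d) - of_nat q ^ (j * d)) / of_nat q ^ (Suc j * e))"
proof -
  have fin: "finite (carrier R)"
    using card_J[of 0] J0 q by (intro card_ge_0_finite) simp
  let ?w = "\<lambda>x. 1 / of_nat (card (dot R x ` row_vectors R d)) ^ e :: rat"
  let ?Q = "of_nat q :: rat"
  have Jsub: "k \<le> n \<Longrightarrow> J k \<subseteq> carrier R" for k using decreasing[of 0 k] J0 by simp
  have sub: "vecs_over (J k) d \<subseteq> row_vectors R d" if "k \<le> n" for k
    using Jsub[OF that] unfolding row_vectors_eq_vecs_over by (rule vecs_over_mono)
  (* The summand j belongs to the vectors generating J (n - Suc j), an ideal with q ^ Suc j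
     elements; the leading 1 is the contribution of the zero vector. *)
  have "(\<Sum>x\<in>vecs_over (J (n - m)) d. ?w x) =
      1 + (\<Sum>j<m. (?Q ^ (Suc j * d) - ?Q ^ (j * d)) / ?Q ^ (Suc j * e))" if "m \<le> n" for m
    using that
  proof (induction m)
    case 0
    define z where "z = vec d (\<lambda>_. \<zero>)"
    have z: "vecs_over (J n) d = {z}"
    proof (intro equalityI subsetI)
      fix x assume "x \<in> vecs_over (J n) d"
      then have "x = z" by (intro eq_vecI) (simp_all add: Jn mem_vecs_over_iff z_def)
      then show "x \<in> {z}" by simp
    qed (simp add: Jn mem_vecs_over_iff z_def)
    have zV: "z \<in> row_vectors R d" using sub[of n] z by simp
    have "dot R z ` row_vectors R d \<subseteq> {\<zero>}"
      by (rule dot_image_subset_iff[OF zV zeroideal, THEN iffD2]) (simp add: mem_vecs_over_iff z_def)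
    from subset_singletonD[OF this] zV have "dot R z ` row_vectors R d = {\<zero>}" by auto
    then show ?case by (simp add: z)
  next
    case (Suc m)
    define k where "k = n - Suc m"
    have k: "k < n" "n - m = Suc k" "n - k = Suc m" using Suc.prems by (auto simp: k_def)
    have w: "?w x = 1 / ?Q ^ (Suc m * e)" if x: "x \<in> vecs_over (J k) d - vecs_over (J (Suc k)) d" for x
    proof -
      have xV: "x \<in> row_vectors R d" using x sub[OF less_imp_le[OF k(1)]] by blast
      obtain l where l: "l \<le> n" "dot R x ` row_vectors R d = J l"
        using ideals[THEN iffD1, OF ideal_dot_image[OF xV]] by blast
      have "ideal (J k) R" "ideal (J (Suc k)) R"
        using k less_imp_le Suc_leI unfolding ideals by blast+
      then have "J l \<subseteq> J k" "\<not> J l \<subseteq> J (Suc k)"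
        using dot_image_subset_iff[OF xV] x l by auto
      (* otherwise J l would lie below J (Suc k) in the chain *)
      moreover from this have "l \<le> k" using decreasing[of "Suc k" l] l
        using not_less_eq_eq by blast
      ultimately have "J l = J k" using decreasing[of l k] k by auto
      then show ?thesis using l card_J[of k] k by (simp only: less_imp_le power_mult of_nat_power)
    qed
    have fink: "finite (vecs_over (J k) d)"
      using k fin Jsub[of k] by (intro finite_vecs_over) (auto intro: finite_subset)
    have ss: "vecs_over (J (Suc k)) d \<subseteq> vecs_over (J k) d"
      using decreasing[of k "Suc k"] k by (intro vecs_over_mono) auto
    have "of_nat (card (vecs_over (J k) d - vecs_over (J (Suc k)) d)) =
        (of_nat (card (vecs_over (J k) d)) - of_nat (card (vecs_over (J (Suc k)) d)) :: rat)"
      using fink ss by (simp add: card_Diff_subset finite_subset card_mono of_nat_diff)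
    also have "\<dots> = ?Q ^ (Suc m * d) - ?Q ^ (m * d)"
    proof -
      have "n - Suc k = m" using k by simp
      then show ?thesis using k card_J[of k] card_J[of "Suc k"]
        by (simp only: card_vecs_over power_mult of_nat_power less_imp_le Suc_leI)
    qed
    finally have card: "of_nat (card (vecs_over (J k) d - vecs_over (J (Suc k)) d)) =
      ?Q ^ (Suc m * d) - ?Q ^ (m * d)" .
    have "(\<Sum>x\<in>vecs_over (J k) d. ?w x) =
        (\<Sum>x\<in>vecs_over (J k) d - vecs_over (J (Suc k)) d. ?w x) + (\<Sum>x\<in>vecs_over (J (Suc k)) d. ?w x)"
      using ss fink by (rule sum.subset_diff)
    also have "(\<Sum>x\<in>vecs_over (J k) d - vecs_over (J (Suc k)) d. ?w x) =
        (?Q ^ (Suc m * d) - ?Q ^ (m * d)) / ?Q ^ (Suc m * e)"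
      by (simp add: w card del: mult_Suc)
    also have "(\<Sum>x\<in>vecs_over (J (Suc k)) d. ?w x) =
        1 + (\<Sum>j<m. (?Q ^ (Suc j * d) - ?Q ^ (j * d)) / ?Q ^ (Suc j * e))"
      using Suc.IH Suc.prems unfolding k(2) by (meson Suc_leD)
    finally show ?case unfolding k_def[symmetric] sum.lessThan_Suc by (simp only: ac_simps)
  qed
  from this[of n] show ?thesis
    unfolding ask_matrices[OF fin] row_vectors_eq_vecs_over diff_self_eq_0 J0 by simp
qed

section \<open>The quotients of the valuation ring\<close>

context discretely_valued_field
begin

text \<open>
The power \<open>P\<^sup>n\<close> in terms of the valuation, see \<open>maximal_ideal_power_eq_val_ideal\<close> below.
\<close>

definition val_ideal :: "nat \<Rightarrow> 'a set"
  where "val_ideal n = {x \<in> carrier K. x = \<zero> \<or> int n \<le> v x}"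

abbreviation \<O> where "\<O> \<equiv> valuation_ring K v"

lemma val_ideal_0: "val_ideal 0 = carrier \<O>"
  by (simp add: val_ideal_def)

lemma val_ideal_antimono: "k \<le> l \<Longrightarrow> val_ideal l \<subseteq> val_ideal k"
  by (auto simp: val_ideal_def)

lemma ex_valuation_eq:
  obtains t where "t \<in> carrier K" "t \<noteq> \<zero>" "v t = m"
proof -
  have "m \<in> v ` (carrier K - {\<zero>})" by (simp add: valuation_surj)
  then show ?thesis using that by blast
qed

lemma valuation_divides:
  assumes "x \<in> carrier K" "x \<noteq> \<zero>" "y \<in> carrier K" "y = \<zero> \<or> v x + m \<le> v y"
  obtains c where "c \<in> carrier K" "c = \<zero> \<or> m \<le> v c" "y = x \<otimes> c"
proof
  have x: "inv x \<in> carrier K" "v (inv x) = - v x" "x \<otimes> inv x = \<one>"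
    using valuation_inv[of x] assms field_Units by auto
  show "inv x \<otimes> y \<in> carrier K" using x assms by simp
  show "inv x \<otimes> y = \<zero> \<or> m \<le> v (inv x \<otimes> y)"
    using mult_bound[of "inv x" y "- v x" "v x + m"] x assms by simp
  have "x \<otimes> (inv x \<otimes> y) = (x \<otimes> inv x) \<otimes> y" by (rule m_assoc[symmetric]) (use x assms in simp_all)
  then show "y = x \<otimes> (inv x \<otimes> y)" using x assms by simp
qed

lemma a_minus_valuation_ring:
  assumes "x \<in> carrier \<O>" "y \<in> carrier \<O>"
  shows "x \<ominus>\<^bsub>\<O>\<^esub> y = x \<ominus> y"
  using assms minus_valuation_ring[of y] by (simp add: a_minus_def)

lemma ideal_val_ideal: "ideal (val_ideal n) \<O>"
proof -
  interpret O: cring \<O> by (rule cring_valuation_ring)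
  show ?thesis
  proof (rule idealI[OF O.ring_axioms])
    show "subgroup (val_ideal n) (add_monoid \<O>)"
    proof (rule O.add.subgroupI)
      fix a assume a: "a \<in> val_ideal n"
      then have "a \<in> carrier \<O>" by (auto simp: val_ideal_def)
      then show "\<ominus>\<^bsub>\<O>\<^esub> a \<in> val_ideal n"
        using minus_bound[of a "int n"] a minus_valuation_ring[of a] by (auto simp: val_ideal_def)
    next
      fix a b assume "a \<in> val_ideal n" "b \<in> val_ideal n"
      then show "a \<oplus>\<^bsub>\<O>\<^esub> b \<in> val_ideal n"
        using add_bound[of a b "int n"] by (auto simp: val_ideal_def)
    qed (auto simp: val_ideal_def)
    fix a x assume ax: "a \<in> val_ideal n" "x \<in> carrier \<O>"
    then show "x \<otimes>\<^bsub>\<O>\<^esub> a \<in> val_ideal n" "a \<otimes>\<^bsub>\<O>\<^esub> x \<in> val_ideal n"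
      using mult_bound[of x a 0 "int n"] mult_bound[of a x "int n" 0] by (auto simp: val_ideal_def)
  qed
qed

lemma maximal_ideal_eq_val_ideal: "maximal_ideal \<O> = val_ideal 1"
  by (auto simp: maximal_ideal_valuation_ring val_ideal_def)

text \<open>
An element of valuation at least \<open>n + 1\<close> is already a single product of an element of valuation
\<open>n\<close> and one of positive valuation, because the valuation takes every integer value.
\<close>

lemma maximal_ideal_power_eq_val_ideal: "maximal_ideal_power \<O> n = val_ideal n"
proof (induction n)
  case 0
  show ?case by (simp add: maximal_ideal_power_def ideals_set_def val_ideal_0 del: valuation_ring_simps)
next
  case (Suc n)
  have "maximal_ideal_power \<O> (Suc n) = ideal_prod \<O> (val_ideal n) (val_ideal 1)"
    using Suc.IH
    by (simp add: maximal_ideal_power_def maximal_ideal_eq_val_ideal ideals_set_def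
        del: valuation_ring_simps)
  also have "\<dots> = val_ideal (Suc n)"
  proof (intro equalityI subsetI)
    fix x assume "x \<in> ideal_prod \<O> (val_ideal n) (val_ideal 1)"
    then show "x \<in> val_ideal (Suc n)"
    proof induction
      case (prod i j)
      then show ?case using mult_bound[of i j "int n" 1] by (auto simp: val_ideal_def)
    next
      case (sum s1 s2)
      then show ?case using add_bound[of s1 s2 "int (Suc n)"] by (auto simp: val_ideal_def)
    qed
  next
    fix x assume x: "x \<in> val_ideal (Suc n)"
    obtain t where t: "t \<in> carrier K" "t \<noteq> \<zero>" "v t = int n" by (rule ex_valuation_eq)
    obtain c where c: "c \<in> carrier K" "c = \<zero> \<or> 1 \<le> v c" "x = t \<otimes> c"
      by (rule valuation_divides[of t x 1]) (use x t in \<open>auto simp: val_ideal_def\<close>)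
    have "t \<otimes>\<^bsub>\<O>\<^esub> c \<in> ideal_prod \<O> (val_ideal n) (val_ideal 1)"
      using t c by (intro ideal_prod.prod) (auto simp: val_ideal_def)
    then show "x \<in> ideal_prod \<O> (val_ideal n) (val_ideal 1)" using c by simp
  qed
  finally show ?case .
qed

definition coset :: "nat \<Rightarrow> 'a \<Rightarrow> 'a set"
  where "coset n x = val_ideal n +>\<^bsub>\<O>\<^esub> x"

text \<open>
For \<open>k \<le> n\<close> this is the ideal \<open>P\<^sup>k/P\<^sup>n\<close>.
\<close>

definition quot_ideal :: "nat \<Rightarrow> nat \<Rightarrow> 'a set set"
  where "quot_ideal n k = coset n ` val_ideal k"

lemma quot_level_eq: "quot_level \<O> n = \<O> Quot val_ideal n"
  by (simp add: quot_level_def maximal_ideal_power_eq_val_ideal)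

lemma residue_field_eq_quot_level: "residue_field \<O> = quot_level \<O> 1"
  by (simp add: residue_field_def quot_level_eq maximal_ideal_eq_val_ideal)

lemma cring_quot_level: "cring (quot_level \<O> n)"
  unfolding quot_level_eq by (rule ideal.quotient_is_cring[OF ideal_val_ideal cring_valuation_ring])

lemma coset_ring_hom: "coset n \<in> Ring.ring_hom \<O> (quot_level \<O> n)"
proof -
  have "coset n = (+>\<^bsub>\<O>\<^esub>) (val_ideal n)" by (simp add: coset_def fun_eq_iff)
  then show ?thesis
    unfolding quot_level_eq by (simp only: ideal.rcos_ring_hom[OF ideal_val_ideal])
qed

lemma carrier_quot_level: "carrier (quot_level \<O> n) = coset n ` carrier \<O>"
  unfolding quot_level_eq FactRing_def A_RCOSETS_def' coset_def by auto

lemma zero_quot_level: "\<zero>\<^bsub>quot_level \<O> n\<^esub> = coset n \<zero>"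
proof -
  interpret h: ring_hom_ring \<O> "quot_level \<O> n" "coset n"
    using cring_valuation_ring cring_quot_level coset_ring_hom
    by (intro ring_hom_ringI2) (auto simp: cring_def)
  show ?thesis using h.hom_zero by simp
qed

lemma coset_eq_iff:
  assumes "x \<in> carrier \<O>" "y \<in> carrier \<O>"
  shows "coset n x = coset n y \<longleftrightarrow> x \<ominus> y \<in> val_ideal n"
proof -
  interpret O: cring \<O> by (rule cring_valuation_ring)
  show ?thesis
    using O.quotient_eq_iff_same_a_r_cos[OF ideal_val_ideal assms] a_minus_valuation_ring[OF assms]
    by (simp add: coset_def)
qed

text \<open>
Membership in \<open>P\<^sup>k/P\<^sup>n\<close> can be tested on any representative, since \<open>P\<^sup>n\<close> is contained in \<open>P\<^sup>k\<close>.
\<close>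

lemma coset_mem_quot_ideal_iff:
  assumes "x \<in> carrier \<O>" "k \<le> n"
  shows "coset n x \<in> quot_ideal n k \<longleftrightarrow> x \<in> val_ideal k"
proof
  assume "coset n x \<in> quot_ideal n k"
  then obtain y where y: "y \<in> val_ideal k" "coset n x = coset n y"
    by (auto simp: quot_ideal_def)
  have yO: "y \<in> carrier \<O>" using y val_ideal_antimono[of 0 k] val_ideal_0 by blast
  have "x \<ominus> y \<in> val_ideal k"
    using coset_eq_iff[OF assms(1) yO] y val_ideal_antimono[OF assms(2)] by blast
  then have "(x \<ominus> y) \<oplus> y \<in> val_ideal k"
    using y add_bound[of "x \<ominus> y" y "int k"] by (auto simp: val_ideal_def)
  moreover have "(x \<ominus> y) \<oplus> y = x"
    using assms yO by (simp add: a_minus_def a_assoc l_neg)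
  ultimately show "x \<in> val_ideal k" by simp
qed (simp add: quot_ideal_def)

lemma quot_ideal_top: "quot_ideal n n = {\<zero>\<^bsub>quot_level \<O> n\<^esub>}"
proof -
  have "coset n y = coset n \<zero>" if "y \<in> val_ideal n" for y
    using that coset_eq_iff[of y \<zero> n] by (auto simp: val_ideal_def a_minus_def)
  moreover have "\<zero> \<in> val_ideal n" by (simp add: val_ideal_def)
  ultimately show ?thesis unfolding quot_ideal_def zero_quot_level by blast
qed

text \<open>
An ideal \<open>I\<close> of the quotient equals the smallest \<open>P\<^sup>k/P\<^sup>n\<close> containing it: if \<open>k < n\<close>, then some coset in
\<open>I\<close> has a representative of valuation exactly \<open>k\<close>, and every element of \<open>P\<^sup>k\<close> is a multiple of that
representative.
\<close>

lemma ideal_quot_level_iff: "ideal I (quot_level \<O> n) \<longleftrightarrow> (\<exists>k\<le>n. I = quot_ideal n k)"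
proof
  interpret O: cring \<O> by (rule cring_valuation_ring)
  show "ideal I (quot_level \<O> n)" if ex: "\<exists>k\<le>n. I = quot_ideal n k"
  proof -
    obtain k where "I = quot_ideal n k" using ex by blast
    then have "I = (+>\<^bsub>\<O>\<^esub>) (val_ideal n) ` val_ideal k"
      by (auto simp: quot_ideal_def coset_def)
    then show ?thesis
      unfolding quot_level_eq
      using O.ring_ideal_imp_quot_ideal[OF ideal_val_ideal ideal_val_ideal] by simp
  qed
  assume I: "ideal I (quot_level \<O> n)"
  interpret I: ideal I "quot_level \<O> n" by (rule I)
  have carr: "I \<subseteq> coset n ` carrier \<O>" using I.a_subset by (simp add: carrier_quot_level)
  define k where "k = (GREATEST k. k \<le> n \<and> I \<subseteq> quot_ideal n k)"
  have "0 \<le> n \<and> I \<subseteq> quot_ideal n 0"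
    using carr unfolding quot_ideal_def val_ideal_0 by simp
  then have k: "k \<le> n" "I \<subseteq> quot_ideal n k"
    using GreatestI_nat[of "\<lambda>k. k \<le> n \<and> I \<subseteq> quot_ideal n k" 0 n] unfolding k_def by auto
  have "quot_ideal n k \<subseteq> I"
  proof (cases "k = n")
    case True
    then show ?thesis
      using additive_subgroup.zero_closed[OF ideal.axioms(1)[OF I]] by (simp add: quot_ideal_top)
  next
    case False
    then have "Suc k \<le> n" using k by simp
    have "\<not> I \<subseteq> quot_ideal n (Suc k)"
    proof
      assume "I \<subseteq> quot_ideal n (Suc k)"
      then have "Suc k \<le> k"
        unfolding k_def using \<open>Suc k \<le> n\<close>
        by (intro Greatest_le_nat[of _ _ n]) (auto simp: k_def)
      then show False by simp
    qed
    then obtain x where x: "x \<in> carrier \<O>" "coset n x \<in> I" "coset n x \<notin> quot_ideal n (Suc k)"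
      using carr by blast
    have "x \<in> val_ideal k" "x \<notin> val_ideal (Suc k)"
      using x k coset_mem_quot_ideal_iff[of x _ n] \<open>Suc k \<le> n\<close> by auto
    then have vx: "x \<in> carrier K" "x \<noteq> \<zero>" "v x = int k" by (auto simp: val_ideal_def)
    show ?thesis
      unfolding quot_ideal_def
    proof (rule image_subsetI)
      fix y assume y: "y \<in> val_ideal k"
      obtain c where c: "c \<in> carrier K" "c = \<zero> \<or> 0 \<le> v c" "y = x \<otimes> c"
        by (rule valuation_divides[of x y 0]) (use y vx in \<open>auto simp: val_ideal_def\<close>)
      then have cO: "c \<in> carrier \<O>" by simp
      have "coset n y = coset n x \<otimes>\<^bsub>quot_level \<O> n\<^esub> coset n c"
        using ring_hom_mult[OF coset_ring_hom x(1) cO] c by simp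
      also have "\<dots> \<in> I"
        using x(2) cO by (intro I.I_r_closed) (auto simp: carrier_quot_level)
      finally show "coset n y \<in> I" .
    qed
  qed
  with k show "\<exists>k\<le>n. I = quot_ideal n k" by blast
qed

text \<open>
Digit expansion.  Fix \<open>t\<close> of valuation \<open>k\<close> and a system of representatives of the residue field.
Each element of \<open>P\<^sup>k\<close> is uniquely \<open>t c + y\<close> with \<open>c\<close> a representative and \<open>y \<in> P\<^bsup>k+1\<^esup>\<close>.  Since
\<open>n \<ge> k + 1\<close>, its coset modulo \<open>P\<^sup>n\<close> still determines \<open>c\<close>, and then also the coset of \<open>y\<close>.
\<close>

lemma card_quot_ideal_Suc:
  assumes "Suc k \<le> n"
  shows "card (quot_ideal n k) = card (carrier (residue_field \<O>)) * card (quot_ideal n (Suc k))"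
proof -
  interpret S: cring "quot_level \<O> n" by (rule cring_quot_level)
  obtain t where t: "t \<in> carrier K" "t \<noteq> \<zero>" "v t = int k" by (rule ex_valuation_eq)
  define rep where "rep C = (SOME c. c \<in> carrier \<O> \<and> coset 1 c = C)" for C
  define F where "F = coset 1 ` carrier \<O>"
  have rep: "rep C \<in> carrier \<O>" "coset 1 (rep C) = C" if "C \<in> F" for C
    using that someI_ex[of "\<lambda>c. c \<in> carrier \<O> \<and> coset 1 c = C"] unfolding rep_def F_def by blast+
  have tO: "t \<otimes> c \<in> val_ideal k" "t \<otimes> c \<in> carrier \<O>" if "c \<in> carrier \<O>" for c
    using that t mult_bound[of t c "int k" 0] by (auto simp: val_ideal_def)
  have sub: "val_ideal (Suc k) \<subseteq> carrier \<O>" "val_ideal k \<subseteq> carrier \<O>"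
    using val_ideal_antimono[of 0] val_ideal_0 by blast+
  (* Multiplication by t shifts the valuation by k, hence congruence modulo P to congruence
     modulo the (k + 1)-st power of P. *)
  have t_diff: "c \<ominus> c' \<in> val_ideal 1 \<longleftrightarrow> t \<otimes> c \<ominus> t \<otimes> c' \<in> val_ideal (Suc k)"
    if "c \<in> carrier \<O>" "c' \<in> carrier \<O>" for c c'
  proof -
    have cc: "c \<ominus> c' \<in> carrier K" and eq: "t \<otimes> c \<ominus> t \<otimes> c' = t \<otimes> (c \<ominus> c')"
      using that t by (simp_all add: a_minus_def r_distr r_minus)
    show ?thesis
      using t cc valuation_mult[of t "c \<ominus> c'"] integral_iff[of t "c \<ominus> c'"]
      unfolding eq val_ideal_def by (cases "c \<ominus> c' = \<zero>") auto
  qed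
  let ?g = "\<lambda>(C, Y). coset n (t \<otimes> rep C) \<oplus>\<^bsub>quot_level \<O> n\<^esub> Y"
  have add: "coset n x \<oplus>\<^bsub>quot_level \<O> n\<^esub> coset n y = coset n (x \<oplus> y)"
    if "x \<in> carrier \<O>" "y \<in> carrier \<O>" for x y
    using ring_hom_add[OF coset_ring_hom that] by simp
  have "bij_betw ?g (F \<times> quot_ideal n (Suc k)) (quot_ideal n k)"
  proof (rule bij_betw_imageI)
    show "inj_on ?g (F \<times> quot_ideal n (Suc k))"
    proof (rule inj_onI, clarify)
      fix C Y C' Y'
      assume C: "C \<in> F" "C' \<in> F" and Y: "Y \<in> quot_ideal n (Suc k)" "Y' \<in> quot_ideal n (Suc k)"
        and eq: "coset n (t \<otimes> rep C) \<oplus>\<^bsub>quot_level \<O> n\<^esub> Y = coset n (t \<otimes> rep C') \<oplus>\<^bsub>quot_level \<O> n\<^esub> Y'"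
      obtain y y' where y: "y \<in> val_ideal (Suc k)" "Y = coset n y" "y' \<in> val_ideal (Suc k)" "Y' = coset n y'"
        using Y by (auto simp: quot_ideal_def)
      let ?c = "t \<otimes> rep C" and ?c' = "t \<otimes> rep C'"
      note c = tO(2)[OF rep(1)[OF C(1)]] tO(2)[OF rep(1)[OF C(2)]]
      have yO: "y \<in> carrier \<O>" "y' \<in> carrier \<O>" using y sub by auto
      have "coset n (?c \<oplus> y) = coset n (?c' \<oplus> y')" using eq y add c yO by simp
      moreover have "?c \<oplus> y \<in> carrier \<O>" "?c' \<oplus> y' \<in> carrier \<O>"
        using c yO cring.cring_simprules(1)[OF cring_valuation_ring] by auto
      ultimately have "(?c \<oplus> y) \<ominus> (?c' \<oplus> y') \<in> val_ideal n" using coset_eq_iff by blast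
      then have "(?c \<oplus> y) \<ominus> (?c' \<oplus> y') \<in> val_ideal (Suc k)"
        using val_ideal_antimono[OF assms] by blast
      moreover have "\<ominus> y \<in> val_ideal (Suc k)"
        using y minus_bound[of y "int (Suc k)"] by (auto simp: val_ideal_def)
      then have "y' \<oplus> \<ominus> y \<in> val_ideal (Suc k)"
        using y add_bound[of y' "\<ominus> y" "int (Suc k)"] by (auto simp: val_ideal_def)
      ultimately have "((?c \<oplus> y) \<ominus> (?c' \<oplus> y')) \<oplus> (y' \<oplus> \<ominus> y) \<in> val_ideal (Suc k)"
        using add_bound[of "(?c \<oplus> y) \<ominus> (?c' \<oplus> y')" "y' \<oplus> \<ominus> y" "int (Suc k)"]
        by (simp add: val_ideal_def)
      moreover have "((?c \<oplus> y) \<ominus> (?c' \<oplus> y')) \<oplus> (y' \<oplus> \<ominus> y) = ?c \<ominus> ?c'"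
      proof -
        have K: "?c \<in> carrier K" "?c' \<in> carrier K" "y \<in> carrier K" "y' \<in> carrier K"
          using c yO by auto
        show ?thesis using K by algebra
      qed
      ultimately have "rep C \<ominus> rep C' \<in> val_ideal 1" using t_diff rep(1) C by simp
      then have CC: "C = C'" using coset_eq_iff[of "rep C" "rep C'" 1] rep C by metis
      have "coset n ?c \<in> carrier (quot_level \<O> n)" "Y \<in> carrier (quot_level \<O> n)" "Y' \<in> carrier (quot_level \<O> n)"
        using c y yO by (auto simp only: carrier_quot_level)
      then have "Y = Y'" using eq CC S.add.l_cancel by metis
      with CC show "C = C' \<and> Y = Y'" by simp
    qed
    show "?g ` (F \<times> quot_ideal n (Suc k)) = quot_ideal n k"
    proof (intro equalityI subsetI)
      fix z assume "z \<in> ?g ` (F \<times> quot_ideal n (Suc k))"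
      then obtain C y where C: "C \<in> F" "y \<in> val_ideal (Suc k)"
        "z = coset n (t \<otimes> rep C) \<oplus>\<^bsub>quot_level \<O> n\<^esub> coset n y"
        by (auto simp: quot_ideal_def)
      note c = tO[OF rep(1)[OF C(1)]]
      have y: "y \<in> carrier \<O>" "y \<in> val_ideal k" using C sub val_ideal_antimono[of k "Suc k"] by auto
      have "z = coset n (t \<otimes> rep C \<oplus> y)" using C(3) add[OF c(2) y(1)] by simp
      moreover have "t \<otimes> rep C \<oplus> y \<in> val_ideal k"
        using c y add_bound[of "t \<otimes> rep C" y "int k"] by (auto simp: val_ideal_def)
      ultimately show "z \<in> quot_ideal n k" by (simp add: quot_ideal_def)
    next
      fix z assume "z \<in> quot_ideal n k"
      then obtain x where x: "x \<in> val_ideal k" "z = coset n x" by (auto simp: quot_ideal_def)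
      obtain c where c: "c \<in> carrier K" "c = \<zero> \<or> 0 \<le> v c" "x = t \<otimes> c"
        by (rule valuation_divides[of t x 0]) (use x t in \<open>auto simp: val_ideal_def\<close>)
      then have cO: "c \<in> carrier \<O>" by simp
      let ?C = "coset 1 c"
      have C: "?C \<in> F" using cO by (simp add: F_def del: valuation_ring_simps)
      let ?y = "t \<otimes> c \<ominus> t \<otimes> rep ?C"
      have "c \<ominus> rep ?C \<in> val_ideal 1" using coset_eq_iff[OF cO rep(1)[OF C]] rep(2)[OF C] by metis
      then have y: "?y \<in> val_ideal (Suc k)" using t_diff[OF cO rep(1)[OF C]] by simp
      have "t \<otimes> rep ?C \<oplus> ?y = x"
      proof -
        have "t \<otimes> rep ?C \<in> carrier K" "t \<otimes> c \<in> carrier K" using t c rep(1)[OF C] by auto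
        then have "t \<otimes> rep ?C \<oplus> ?y = t \<otimes> c" by algebra
        then show ?thesis using c by simp
      qed
      then have "z = ?g (?C, coset n ?y)"
        using x add[OF tO(2)[OF rep(1)[OF C]], of ?y] y sub by auto
      moreover have "(?C, coset n ?y) \<in> F \<times> quot_ideal n (Suc k)"
        using C y by (simp add: quot_ideal_def)
      ultimately show "z \<in> ?g ` (F \<times> quot_ideal n (Suc k))" by blast
    qed
  qed
  then have "card (F \<times> quot_ideal n (Suc k)) = card (quot_ideal n k)" by (rule bij_betw_same_card)
  then show ?thesis
    by (simp add: card_cartesian_product F_def residue_field_eq_quot_level carrier_quot_level
        del: valuation_ring_simps)
qed

lemma card_quot_ideal:
  assumes "k \<le> n"
  shows "card (quot_ideal n k) = card (carrier (residue_field \<O>)) ^ (n - k)"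
  using assms
proof (induction k rule: inc_induct)
  case base
  show ?case by (simp add: quot_ideal_top)
next
  case (step k)
  have "card (quot_ideal n k) = card (carrier (residue_field \<O>)) * card (quot_ideal n (Suc k))"
    using step.hyps by (intro card_quot_ideal_Suc) simp
  also have "\<dots> = card (carrier (residue_field \<O>)) ^ Suc (n - Suc k)"
    by (simp only: step.IH power_Suc)
  also have "Suc (n - Suc k) = n - k" using step.hyps(2) by (rule Suc_diff_Suc)
  finally show ?case .
qed

end

section \<open>The zeta function\<close>

lemma reduction_matrices:
  "reduction R n (matrices R d e) =
    {A \<in> carrier_mat d e. elements_mat A \<subseteq> (\<lambda>x. maximal_ideal_power R n +>\<^bsub>R\<^esub> x) ` carrier R}"
  (is "_ = ?M")
proof -
  let ?f = "\<lambda>x. maximal_ideal_power R n +>\<^bsub>R\<^esub> x"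
  show ?thesis
    unfolding reduction_def
  proof (intro equalityI subsetI)
    fix B assume "B \<in> map_mat ?f ` matrices R d e"
    then obtain A where A: "A \<in> carrier_mat d e" "elements_mat A \<subseteq> carrier R" "B = map_mat ?f A"
      by (auto simp: matrices_def)
    then show "B \<in> ?M" by (simp add: image_mono)
  next
    fix B assume B: "B \<in> ?M"
    define A where "A = map_mat (inv_into (carrier R) ?f) B"
    have inB: "B $$ (i, j) \<in> ?f ` carrier R" if "i < d" "j < e" for i j
    proof -
      have "B \<in> carrier_mat d e" using B by simp
      from elements_matI[OF this that refl] show ?thesis using B by blast
    qed
    have dB: "dim_row B = d" "dim_col B = e" using B by auto
    have "A \<in> matrices R d e"
      unfolding mem_matrices_iff A_def
    proof (intro conjI allI impI)
      show "map_mat (inv_into (carrier R) ?f) B \<in> carrier_mat d e" using B by simp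
      fix i j assume "i < d" "j < e"
      then show "map_mat (inv_into (carrier R) ?f) B $$ (i, j) \<in> carrier R"
        using inv_into_into[OF inB] dB by simp
    qed
    moreover have "map_mat ?f A = B"
    proof (rule eq_matI)
      fix i j assume "i < dim_row B" "j < dim_col B"
      then show "map_mat ?f A $$ (i, j) = B $$ (i, j)"
        using f_inv_into_f[OF inB, of i j] dB by (simp add: A_def)
    qed (simp_all add: A_def)
    ultimately show "B \<in> map_mat ?f ` matrices R d e" by blast
  qed
qed

lemma (in discretely_valued_field) reduction_matrices_valuation_ring:
  "reduction \<O> n (matrices \<O> d e) = matrices (quot_level \<O> n) d e"
proof -
  have "coset n = (+>\<^bsub>\<O>\<^esub>) (val_ideal n)" by (simp add: coset_def fun_eq_iff)
  then show ?thesis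
    unfolding reduction_matrices matrices_def[of "quot_level \<O> n"] carrier_quot_level
    by (simp only: maximal_ideal_power_eq_val_ideal)
qed

text \<open>
Multiplication by \<open>1 - T\<close> turns the partial sums into the sequence of their terms, and
multiplication by \<open>1 - r T\<close> then leaves only the coefficients of degree \<open>0\<close> and \<open>1\<close>.
\<close>

lemma fps_geometric_partial_sums:
  fixes r s :: "'a :: field"
  shows "Abs_fps (\<lambda>n. 1 + (\<Sum>j<n. r ^ Suc j - s * r ^ j)) =
    (1 - fps_const s * fps_X) / ((1 - fps_X) * (1 - fps_const r * fps_X))"
proof -
  let ?A = "Abs_fps (\<lambda>n. 1 + (\<Sum>j<n. r ^ Suc j - s * r ^ j))"
  define B where "B = Abs_fps (\<lambda>n. case n of 0 \<Rightarrow> 1 | Suc j \<Rightarrow> r ^ Suc j - s * r ^ j)"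
  have AB: "?A * (1 - fps_X) = B"
  proof (rule fps_ext)
    fix n
    show "fps_nth (?A * (1 - fps_X)) n = fps_nth B n"
      by (cases n) (simp_all add: B_def right_diff_distrib)
  qed
  have BC: "B * (1 - fps_const r * fps_X) = 1 - fps_const s * fps_X"
  proof (rule fps_ext)
    fix n
    have "B * (1 - fps_const r * fps_X) = B - fps_const r * (B * fps_X)"
      by (simp add: algebra_simps)
    then have "fps_nth (B * (1 - fps_const r * fps_X)) n =
        fps_nth B n - r * (if n = 0 then 0 else fps_nth B (n - 1))"
      by simp
    also have "\<dots> = fps_nth (1 - fps_const s * fps_X) n"
    proof (cases n)
      case (Suc m)
      then show ?thesis by (cases m) (simp_all add: B_def algebra_simps)
    qed (simp add: B_def)
    finally show "fps_nth (B * (1 - fps_const r * fps_X)) n = fps_nth (1 - fps_const s * fps_X) n" .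
  qed
  have "fps_nth ((1 - fps_X) * (1 - fps_const r * fps_X)) 0 \<noteq> 0" by simp
  then have "(1 - fps_X) * (1 - fps_const r * fps_X) \<noteq> 0" by force
  moreover have "?A * ((1 - fps_X) * (1 - fps_const r * fps_X)) = 1 - fps_const s * fps_X"
    by (simp only: mult.assoc[symmetric] AB BC)
  ultimately show ?thesis by (metis nonzero_mult_div_cancel_right)
qed

lemma (in nonarch_local_field) card_residue_field_pos: "0 < card (carrier (residue_field \<O>))"
proof -
  have "coset 1 \<zero> \<in> carrier (residue_field \<O>)"
    unfolding residue_field_eq_quot_level carrier_quot_level by (intro imageI) simp
  then show ?thesis using finite_residue_field card_gt_0_iff by blast
qed

lemma (in nonarch_local_field) ask_quot_level_matrices:
  defines "q \<equiv> of_nat (card (carrier (residue_field \<O>))) :: rat"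
  shows "ask (quot_level \<O> n) (matrices (quot_level \<O> n) d e) =
    1 + (\<Sum>j<n. (q ^ (Suc j * d) - q ^ (j * d)) / q ^ (Suc j * e))"
proof -
  interpret S: cring "quot_level \<O> n" by (rule cring_quot_level)
  show ?thesis
    unfolding q_def
  proof (rule S.ask_matrices_chain_ring[where J = "quot_ideal n"])
    show "ideal I (quot_level \<O> n) \<longleftrightarrow> (\<exists>k\<le>n. I = quot_ideal n k)" for I
      by (rule ideal_quot_level_iff)
    show "quot_ideal n l \<subseteq> quot_ideal n k" if "k \<le> l" for k l
      unfolding quot_ideal_def by (rule image_mono[OF val_ideal_antimono[OF that]])
    show "card (quot_ideal n k) = card (carrier (residue_field \<O>)) ^ (n - k)" if "k \<le> n" for k
      using that by (rule card_quot_ideal)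
    show "quot_ideal n 0 = carrier (quot_level \<O> n)"
      by (simp only: quot_ideal_def val_ideal_0 carrier_quot_level)
    show "quot_ideal n n = {\<zero>\<^bsub>quot_level \<O> n\<^esub>}" by (rule quot_ideal_top)
    show "0 < card (carrier (residue_field \<O>))" by (rule card_residue_field_pos)
  qed
qed

theorem proposition1p5:
  fixes K :: "('a, 'b) ring_scheme" and v :: "'a \<Rightarrow> int" and d e :: nat
  defines "R \<equiv> valuation_ring K v"
  defines "q \<equiv> (of_nat (card (carrier (residue_field R))) :: rat)"
  assumes "nonarch_local_field K v"
  shows "ask_zeta R (matrices R d e) =
    (1 - fps_const (q powi (- int e)) * fps_X) /
    ((1 - fps_X) * (1 - fps_const (q powi (int d - int e)) * fps_X))"
proof -
  interpret nonarch_local_field K v by (rule assms)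
  have q: "q \<noteq> 0"
    using card_residue_field_pos by (simp only: q_def R_def of_nat_eq_0_iff)
  let ?r = "q powi (int d - int e)" and ?s = "q powi (- int e)"
  have r: "?r = q ^ d / q ^ e" and s: "?s = 1 / q ^ e"
    using q by (simp_all add: power_int_diff power_int_minus_divide)
  have "(q ^ (Suc j * d) - q ^ (j * d)) / q ^ (Suc j * e) = ?r ^ Suc j - ?s * ?r ^ j" for j
  proof -
    have "?r ^ i = q ^ (i * d) / q ^ (i * e)" for i
      unfolding r power_divide by (simp only: power_mult[symmetric] mult.commute)
    moreover have "?s / q ^ (j * e) = 1 / q ^ (Suc j * e)"
      unfolding s by (simp add: power_add)
    ultimately show ?thesis
      by (simp only: diff_divide_distrib times_divide_eq_right times_divide_eq_left
          divide_divide_eq_left s mult_1_left power_add mult_Suc)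
  qed
  then have "ask (quot_level R n) (reduction R n (matrices R d e)) =
      1 + (\<Sum>j<n. ?r ^ Suc j - ?s * ?r ^ j)" for n
    using ask_quot_level_matrices[of n d e] reduction_matrices_valuation_ring[of n d e]
    unfolding R_def[symmetric] q_def[symmetric] by simp
  then show ?thesis unfolding ask_zeta_def by (simp only: fps_geometric_partial_sums)
qed

end
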